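(* For any graph $G$ of order $n$ and any positive integer $t$, $\omega(S(G,t))=\omega(G)$, where $\omega$ denotes the clique number (the maximum number of vertices of a complete subgraph).
   Context: For a graph $G=(V,E)$ and a positive integer $t$, $V^t$ denotes the set of words $u=u_1u_2\cdots u_t$ of length $t$ over the alphabet $V$. The generalized Sierpiński graph $S(G,t)$ has vertex set $V^t$, and $\{u,v\}$ is an edge if and only if there is $i\in\{1,\dots,t\}$ such that: (i) $u_j=v_j$ for all $j<i$; (ii) $u_i\ne v_i$ and $\{u_i,v_i\}\in E$; (iii) $u_j=v_i$ and $v_j=u_i$ for all $j>i$. Graphs are finite, simple and non-empty. *)

theory Defs
  imports "Graph_Theory.Graph_Theory"
begin

text \<open>
  Finite simple graphs are rendered by the locale \<open>pair_graph\<close>: finite, loop-free, symmetric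
  digraphs whose arcs are pairs of vertices, an undirected edge being the two opposite arcs.
  The locale allows the null graph, so non-emptiness has to be assumed separately.
\<close>

text \<open>
  Words of length \<open>t\<close> are lists; list positions are \<open>0, \<dots>, t - 1\<close>.
\<close>

definition words :: "'a set \<Rightarrow> nat \<Rightarrow> 'a list set" where
  "words V t = {u. length u = t \<and> set u \<subseteq> V}"

definition sierpinski :: "'a pair_pre_digraph \<Rightarrow> nat \<Rightarrow> 'a list pair_pre_digraph" where
  "sierpinski G t = \<lparr>
     pverts = words (pverts G) t,
     parcs = {(u, v). u \<in> words (pverts G) t \<and> v \<in> words (pverts G) t \<and>
       (\<exists>i<t. (\<forall>j<i. u ! j = v ! j) \<and>
              u ! i \<noteq> v ! i \<and> (u ! i, v ! i) \<in> parcs G \<and>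
              (\<forall>j. i < j \<and> j < t \<longrightarrow> u ! j = v ! i \<and> v ! j = u ! i))} \<rparr>"

text \<open>
  The maximum is taken over a finite set when \<open>G\<close> is finite, and over a non-empty one because the
  subgraph without vertices counts as \<open>K\<^sub>0\<close>; this does not affect the value for non-empty \<open>G\<close>,
  where every single vertex is a complete subgraph.
\<close>

definition clique_number :: "('a, 'b) pre_digraph \<Rightarrow> nat" where
  "clique_number G = Max {n. \<exists>H. subgraph H G \<and> complete_digraph n H}"

lemma finite_clique_orders:
  assumes "finite (verts G)"
  shows "finite {n. \<exists>H. subgraph H G \<and> complete_digraph n H}"
proof (rule finite_subset)
  show "{n. \<exists>H. subgraph H G \<and> complete_digraph n H} \<subseteq> {..card (verts G)}"
    using assms by (auto simp: subgraph_def complete_digraph_def intro: card_mono)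
qed simp

lemma finite_words:
  assumes "finite V"
  shows "finite (words V t)"
  using finite_lists_length_eq[OF assms, of t] by (simp add: words_def conj_commute)

lemma words_nonempty:
  assumes "V \<noteq> {}"
  shows "words V t \<noteq> {}"
proof -
  obtain x where "x \<in> V" using assms by blast
  then have "replicate t x \<in> words V t" by (auto simp: words_def)
  then show ?thesis by blast
qed

lemma pair_graph_sierpinski:
  assumes "pair_graph G"
  shows "pair_graph (sierpinski G t)"
proof -
  interpret G: pair_graph G by (rule assms)
  have symG: "(y, x) \<in> parcs G" if "(x, y) \<in> parcs G" for x y
    using G.pair_sym_arcs that by (simp add: symmetric_def sym_def)
  define P where "P u v i \<longleftrightarrow> (\<forall>j<i. u ! j = v ! j) \<and>
      u ! i \<noteq> v ! i \<and> (u ! i, v ! i) \<in> parcs G \<and>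
      (\<forall>j. i < j \<and> j < t \<longrightarrow> u ! j = v ! i \<and> v ! j = u ! i)" for u v :: "'a list" and i
  have P_sym: "P v u i" if "P u v i" for u v i
    using that symG unfolding P_def by metis
  have V: "pverts (sierpinski G t) = words (pverts G) t"
    by (simp add: sierpinski_def)
  have E: "(u, v) \<in> parcs (sierpinski G t) \<longleftrightarrow>
      u \<in> words (pverts G) t \<and> v \<in> words (pverts G) t \<and> (\<exists>i<t. P u v i)" for u v
    by (simp only: sierpinski_def P_def pair_pre_digraph.simps mem_Collect_eq case_prod_conv)
  have fin: "finite (words (pverts G) t)"
    by (rule finite_words) (rule G.pair_finite_verts)
  have sub: "parcs (sierpinski G t) \<subseteq> words (pverts G) t \<times> words (pverts G) t"
    using E by (metis mem_Sigma_iff subrelI)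
  have symS: "sym (parcs (sierpinski G t))"
    by (rule symI) (metis E P_sym)
  show ?thesis
  proof unfold_locales
    show "finite (pverts (sierpinski G t))" using fin V by simp
    show "finite (parcs (sierpinski G t))"
      using sub fin by (meson finite_SigmaI finite_subset)
    show "symmetric (with_proj (sierpinski G t))" using symS by (simp add: symmetric_def)
    fix e assume e: "e \<in> parcs (sierpinski G t)"
    obtain u v where uv: "e = (u, v)" by (cases e)
    show "fst e \<in> pverts (sierpinski G t)" "snd e \<in> pverts (sierpinski G t)"
      using e uv E V by simp_all
    have "u \<noteq> v" using e uv E unfolding P_def by metis
    then show "fst e \<noteq> snd e" using uv by simp
  qed
qed

end

theory Submission
  imports Defs
begin

text \<open>
  Appending a letter to a fixed prefix embeds \<open>G\<close> into \<open>S(G,t)\<close>. Conversely, an edge \<open>uv\<close> of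
  \<open>S(G,t)\<close> first differs at some position \<open>i\<close>, and then \<open>u\<close> is determined by its first \<open>i + 1\<close>
  letters and the letter \<open>v ! i\<close>. So in a triangle \<open>uvw\<close>, the positions of \<open>uv\<close> and \<open>uw\<close> coincide:
  if \<open>uw\<close> differed strictly earlier than \<open>uv\<close>, then \<open>w\<close> would force \<open>u = v\<close>. Hence one position
  serves for all pairs of a clique, and reading off the letters there gives a clique of \<open>G\<close>
  of the same order.
\<close>

text \<open>Bare vertex sets replace subgraph witnesses, so that cliques can be carried between the
  two graphs as images under maps of vertices.\<close>

definition is_clique :: "'a pair_pre_digraph \<Rightarrow> 'a set \<Rightarrow> bool" where
  "is_clique G K \<longleftrightarrow> K \<subseteq> pverts G \<and> (\<forall>x\<in>K. \<forall>y\<in>K. x \<noteq> y \<longrightarrow> (x, y) \<in> parcs G)"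

lemma clique_of_complete_subgraph:
  assumes "subgraph H (with_proj G)" "complete_digraph m H"
  shows "is_clique G (verts H) \<and> card (verts H) = m"
proof -
  have ends: "arcs_ends H = {(u, v). (u, v) \<in> verts H \<times> verts H \<and> u \<noteq> v}"
    and card: "card (verts H) = m"
    using assms(2) unfolding complete_digraph_def by auto
  have sub: "verts H \<subseteq> pverts G" "arcs H \<subseteq> parcs G" "compatible (with_proj G) H"
    using assms(1) unfolding subgraph_def by auto
  \<comment> \<open>Compatibility gives \<open>H\<close> the projections \<open>fst\<close> and
    \<open>snd\<close> as tail and head, so each arc is its own pair of ends.\<close>
  have "arcs_ends H \<subseteq> parcs G"
    using sub by (auto simp: arcs_ends_def arc_to_ends_def compatible_def)
  then show ?thesis using ends card sub(1) unfolding is_clique_def by blast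
qed

lemma complete_subgraph_of_clique:
  assumes "pair_graph G" "is_clique G K"
  shows "\<exists>H. subgraph H (with_proj G) \<and> complete_digraph (card K) H"
proof -
  interpret G: pair_graph G by (rule assms(1))
  define P where "P = \<lparr>pverts = K, parcs = {(u, v). u \<in> K \<and> v \<in> K \<and> u \<noteq> v}\<rparr>"
  have K: "K \<subseteq> pverts G" and arcs: "parcs P \<subseteq> parcs G"
    using assms(2) unfolding is_clique_def P_def by auto
  have fin: "finite K" using K G.pair_finite_verts finite_subset by blast
  have "complete_digraph (card K) (with_proj P)"
    using fin by (simp add: complete_digraph_pair_def P_def)
  moreover have "subgraph (with_proj P) (with_proj G)"
    using K arcs G.wf_digraph
    by (auto simp: subgraph_def compatible_def P_def wf_digraph_wp_iff pair_wf_digraph_def)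
  ultimately show ?thesis by blast
qed

lemma clique_number_eq_Max_cliques:
  assumes "pair_graph G"
  shows "clique_number (with_proj G) = Max {card K | K. is_clique G K}"
proof -
  have "{m. \<exists>H. subgraph H (with_proj G) \<and> complete_digraph m H} = {card K | K. is_clique G K}"
    using clique_of_complete_subgraph complete_subgraph_of_clique[OF assms] by blast
  then show ?thesis by (simp add: clique_number_def)
qed

text \<open>The existential witness of the edge relation becomes a parameter \<open>i\<close>, so
  that the positions of different edges can be compared.\<close>

definition sierpinski_edge_at :: "('a \<times> 'a) set \<Rightarrow> nat \<Rightarrow> nat \<Rightarrow> 'a list \<Rightarrow> 'a list \<Rightarrow> bool" where
  "sierpinski_edge_at E t i u v \<longleftrightarrow> i < t \<and> (\<forall>j<i. u ! j = v ! j) \<and>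
     u ! i \<noteq> v ! i \<and> (u ! i, v ! i) \<in> E \<and>
     (\<forall>j. i < j \<and> j < t \<longrightarrow> u ! j = v ! i \<and> v ! j = u ! i)"

lemma pverts_sierpinski [simp]: "pverts (sierpinski G t) = words (pverts G) t"
  by (simp add: sierpinski_def)

lemma parcs_sierpinski_iff:
  "(u, v) \<in> parcs (sierpinski G t) \<longleftrightarrow>
     u \<in> words (pverts G) t \<and> v \<in> words (pverts G) t \<and>
     (\<exists>i. sierpinski_edge_at (parcs G) t i u v)"
  by (simp only: sierpinski_def sierpinski_edge_at_def pair_pre_digraph.simps mem_Collect_eq
      case_prod_conv)

lemma triangle_edge_position_le:
  assumes "length u = t" "length v = t" "u \<noteq> v"
    and uv: "sierpinski_edge_at E t i u v"
    and uw: "sierpinski_edge_at E t k u w"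
    and vw: "sierpinski_edge_at E t l v w"
  shows "i \<le> k"
proof (rule ccontr)
  assume "\<not> i \<le> k"
  then have ki: "k < i" by simp
  have eq: "u ! j = v ! j" if "j < i" for j
    using uv that unfolding sierpinski_edge_at_def by blast
  \<comment> \<open>The position of an edge is the first place where its ends differ. Since
    \<open>u\<close> and \<open>v\<close> agree before \<open>i\<close>, and \<open>k < i\<close>,
    the word \<open>w\<close> departs from both at the same place.\<close>
  have "l = k"
  proof (rule linorder_cases)
    assume "l < k"
    then have "u ! l = w ! l" "u ! l = v ! l" "v ! l \<noteq> w ! l"
      using uw vw eq[of l] ki by (auto simp: sierpinski_edge_at_def)
    then show ?thesis by simp
  next
    assume "k < l"
    then have "v ! k = w ! k" "u ! k = v ! k" "u ! k \<noteq> w ! k"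
      using uw vw eq[of k] ki by (auto simp: sierpinski_edge_at_def)
    then show ?thesis by simp
  qed
  \<comment> \<open>Beyond \<open>k\<close> both words repeat the letter
    \<open>w ! k\<close>.\<close>
  then have tail: "u ! j = v ! j" if "k < j" "j < t" for j
    using uw vw that by (simp add: sierpinski_edge_at_def)
  have "u = v"
  proof (rule nth_equalityI)
    show "u ! j = v ! j" if "j < length u" for j
      using that eq tail[of j] ki assms(1) by (cases "j < i") auto
  qed (simp add: assms)
  with \<open>u \<noteq> v\<close> show False ..
qed

lemma clique_sierpinski_position:
  assumes K: "is_clique (sierpinski G t) K" and u: "u \<in> K" and v: "v \<in> K" and "u \<noteq> v"
  obtains i where "\<And>x y. x \<in> K \<Longrightarrow> y \<in> K \<Longrightarrow> x \<noteq> y \<Longrightarrow> sierpinski_edge_at (parcs G) t i x y"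
proof -
  have len: "length x = t" if "x \<in> K" for x
    using K that unfolding is_clique_def by (auto simp: words_def)
  have "\<exists>i. sierpinski_edge_at (parcs G) t i x y" if "x \<in> K" "y \<in> K" "x \<noteq> y" for x y
    using K that unfolding is_clique_def parcs_sierpinski_iff by blast
  then obtain p where
    p: "\<And>x y. x \<in> K \<Longrightarrow> y \<in> K \<Longrightarrow> x \<noteq> y \<Longrightarrow> sierpinski_edge_at (parcs G) t (p x y) x y"
    by metis
  \<comment> \<open>The case \<open>y = z\<close> is split off because only distinct
    \<open>y\<close> and \<open>z\<close> span the third edge of a triangle.\<close>
  have le: "p x y \<le> p x z" if "x \<in> K" "y \<in> K" "z \<in> K" "x \<noteq> y" "x \<noteq> z" for x y z
    using triangle_edge_position_le[of x t y "parcs G" "p x y" "p x z" z "p y z"]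
      len p that by (cases "y = z") auto
  have star: "p x y = p x z" if "x \<in> K" "y \<in> K" "z \<in> K" "x \<noteq> y" "x \<noteq> z" for x y z
    using le that by (meson antisym)
  \<comment> \<open>A first place of difference does not depend on the order of the two
    words.\<close>
  have sym: "p x y = p y x" if "x \<in> K" "y \<in> K" "x \<noteq> y" for x y
  proof (rule linorder_cases)
    assume "p x y < p y x"
    then show ?thesis
      using p[OF that] p[OF that(2,1)] that(3) by (auto simp: sierpinski_edge_at_def)
  next
    assume "p y x < p x y"
    then show ?thesis
      using p[OF that] p[OF that(2,1)] that(3) by (auto simp: sierpinski_edge_at_def)
  qed
  \<comment> \<open>Any pair is linked to the reference pair by \<open>(x, y)\<close>,
    \<open>(x, u)\<close>, \<open>(u, x)\<close>, \<open>(u, v)\<close>, alternating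
    \<open>star\<close> and \<open>sym\<close>.\<close>
  have "p x y = p u v" if "x \<in> K" "y \<in> K" "x \<noteq> y" for x y
  proof (cases "x = u")
    case True
    then show ?thesis using star that u v \<open>u \<noteq> v\<close> by blast
  next
    case False
    then have "p x y = p u x" using star[of x y u] sym[of x u] that u by simp
    also have "\<dots> = p u v" using star[of u x v] False that u v \<open>u \<noteq> v\<close> by simp
    finally show ?thesis .
  qed
  then show thesis using p that by metis
qed

lemma clique_of_clique_sierpinski:
  assumes "pverts G \<noteq> {}" and K: "is_clique (sierpinski G t) K"
  shows "\<exists>L. is_clique G L \<and> card L = card K"
proof (cases "\<exists>u\<in>K. \<exists>v\<in>K. u \<noteq> v")
  case True
  then obtain i where
    i: "\<And>x y. x \<in> K \<Longrightarrow> y \<in> K \<Longrightarrow> x \<noteq> y \<Longrightarrow> sierpinski_edge_at (parcs G) t i x y"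
    using clique_sierpinski_position[OF K] by metis
  have "i < t"
    using True i unfolding sierpinski_edge_at_def by blast
  have verts: "x ! i \<in> pverts G" if "x \<in> K" for x
  proof -
    have "set x \<subseteq> pverts G" "length x = t"
      using K that by (auto simp: is_clique_def words_def)
    then show ?thesis using \<open>i < t\<close> by (meson nth_mem subsetD)
  qed
  have "(x ! i, y ! i) \<in> parcs G" if "x \<in> K" "y \<in> K" "x ! i \<noteq> y ! i" for x y
    using i[of x y] that by (auto simp: sierpinski_edge_at_def)
  then have "is_clique G ((\<lambda>x. x ! i) ` K)"
    using verts by (auto simp: is_clique_def)
  \<comment> \<open>The common position separates any two distinct words of \<open>K\<close>, so no
    vertices are lost.\<close>
  moreover have "inj_on (\<lambda>x. x ! i) K"
    using i unfolding inj_on_def sierpinski_edge_at_def by blast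
  ultimately show ?thesis using card_image by blast
next
  \<comment> \<open>With at most one word there is no edge to supply a position; the empty set or an
    arbitrary single vertex matches the order.\<close>
  case False
  obtain a where "a \<in> pverts G" using assms(1) by blast
  then have "is_clique G {}" "is_clique G {a}" unfolding is_clique_def by auto
  moreover have "card K = card ({} :: 'a set) \<or> card K = card {a}"
  proof -
    have "K = {} \<or> (\<exists>x. K = {x})" using False by blast
    then show ?thesis by auto
  qed
  ultimately show ?thesis by metis
qed

lemma clique_sierpinski_of_clique:
  assumes "t \<ge> 1" "pverts G \<noteq> {}" and L: "is_clique G L"
  shows "\<exists>K. is_clique (sierpinski G t) K \<and> card K = card L"
proof -
  obtain a where a: "a \<in> pverts G" using assms(2) by blast
  \<comment> \<open>Words differing only in their last letter, at index \<open>t - 1\<close>, leave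
    no later positions for the swapping condition to constrain.\<close>
  define f where "f x = replicate (t - 1) a @ [x]" for x
  have words: "f x \<in> words (pverts G) t" if "x \<in> L" for x
    using that a L assms(1) unfolding is_clique_def by (auto simp: words_def f_def)
  have "(f x, f y) \<in> parcs (sierpinski G t)" if "x \<in> L" "y \<in> L" "x \<noteq> y" for x y
  proof -
    have "(x, y) \<in> parcs G" using L that by (simp add: is_clique_def)
    then have "sierpinski_edge_at (parcs G) t (t - 1) (f x) (f y)"
      using that assms(1) by (auto simp: sierpinski_edge_at_def f_def nth_append)
    then show ?thesis using words that by (auto simp: parcs_sierpinski_iff)
  qed
  then have "is_clique (sierpinski G t) (f ` L)"
    using words by (auto simp: is_clique_def)
  moreover have "inj_on f L" by (simp add: inj_on_def f_def)
  ultimately show ?thesis using card_image by blast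
qed

theorem theorem7:
  fixes G :: "'a pair_pre_digraph" and n t :: nat
  assumes "pair_graph G"
    and "pverts G \<noteq> {}"
    and "card (pverts G) = n"
    and "t \<ge> 1"
  shows "clique_number (with_proj (sierpinski G t)) = clique_number (with_proj G)"
proof -
  \<comment> \<open>The sets of clique orders coincide, not just their maxima, so \<open>Max\<close>
    is taken of one and the same set.\<close>
  have "{card K | K. is_clique (sierpinski G t) K} = {card K | K. is_clique G K}" (is "?A = ?B")
  proof
    show "?A \<subseteq> ?B" using clique_of_clique_sierpinski[OF assms(2)] by clarsimp metis
    show "?B \<subseteq> ?A" using clique_sierpinski_of_clique[OF assms(4,2)] by clarsimp metis
  qed
  then show ?thesis
    using assms(1) by (simp add: clique_number_eq_Max_cliques pair_graph_sierpinski)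
qed

end
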